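(* Let a mixed-integer program be given by $A\in\mathbb{R}^{m\times n}$, $b\in\mathbb{R}^m$, $c\in\mathbb{R}^n$ and $p\in\{0,\dots,n\}$, and let $H_{Full}$ be the Full QUBO objective associated with it. If $H_{Full}(\pi^*,\sigma^* )=0$ for some $\pi^*\in\{0,1\}^{n\times n}$ and $\sigma^*\in\{0,1\}^{m\times m}$, then $\pi^*$ is a formulation symmetry. Moreover, if $\bar\pi$ is a formulation symmetry, then there exists some corresponding $\bar\sigma\in\{0,1\}^{m\times m}$ such that $H_{Full}(\bar\pi,\bar\sigma)=0$.
   Context: The mixed-integer program (MIP) is $\max\{c^Tx : Ax\le b,\ x\in\mathbb{Z}^p\times\mathbb{R}^{n-p}\}$, with $n$ variables $x_1,\dots,x_n$ (the first $p$ integer) and $m$ constraints. Formulation symmetry: a variable permutation $\pi\in S_n$ such that there exists a corresponding constraint permutation $\sigma\in S_m$ with (i) $\pi(\{1,\dots,p\})=\{1,\dots,p\}$; (ii) $\pi(c)=c$, i.e. $c_{\pi(j)}=c_j$ for all $j$; (iii) $\sigma(b)=b$, i.e. $b_{\sigma(i)}=b_i$ for all $i$; (iv) $A_{\sigma(i),\pi(j)}=A_{ij}$ for all $i,j$. Matrix convention: a permutation $\pi\in S_n$ is identified with the matrix $\pi\in\{0,1\}^{n\times n}$ such that $\pi_{jj'}=1$ if and only if $\pi(j)=j'$ ($x_j$ is mapped to $x_{j'}$); similarly for $\sigma\in S_m$ and $\sigma\in\{0,1\}^{m\times m}$ ($\sigma_{ii'}=1$ iff constraint $i$ is mapped to constraint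 $i'$). A binary matrix is said to be a formulation symmetry if it is a permutation matrix whose permutation is a formulation symmetry. Reasonable index sets: for a variable index $j$, $r(j)$ is the set of all $j'\in\{1,\dots,n\}$ such that $x_j$ and $x_{j'}$ have the same domain (both integer or both continuous) and $c_j=c_{j'}$. For a constraint index $i$, $r(i)$ is the set of all $i'\in\{1,\dots,m\}$ with $b_i=b_{i'}$. Let $\Pi^\complement$ be the set of entries $\pi_{jj'}$ with $j'\notin r(j)$ and $\Sigma^\complement$ the set of entries $\sigma_{ii'}$ with $i'\notin r(i)$. For $\pi\in\{0,1\}^{n\times n}$, $\sigma\in\{0,1\}^{m\times m}$ define $$H_{B,\pi}=\sum_{j=1}^n\Big(\sum_{j'=1}^n\pi_{jj'}-1\Big)^2+\sum_{j'=1}^n\Big(\sum_{j=1}^n\pi_{jj'}-1\Big)^2,$$ $$H_{B,\sigma}=\sum_{i=1}^m\Big(\sum_{i'=1}^m\sigma_{ii'}-1\Big)^2+\sum_{i'=1}^m\Big(\sum_{i=1}^m\sigma_{ii'}-1\Big)^2,$$ $$H_\pi=\sum_{(j,j'):\,j'\notin r(j)}\pi_{jj'}^2,\qquad H_\sigma=\sum_{(i,i'):\,i'\notin r(i)}\sigma_{ii'}^2,\qquad H_A=\sum_{(i,j,i',j'):\,A_{ij}\ne A_{i'j'}}\sigma_{ii'}\pi_{jj'},$$ and $H_{Full}(\pi,\sigma)=H_{B,\pi}+H_{B,\sigma}+H_\pi+H_\sigma+H_A$. *)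

theory Defs
  imports "Jordan_Normal_Form.Matrix" "HOL-Combinatorics.Permutations"
begin

text \<open>
  The program max \<open>c\<^sup>T x\<close> subject to \<open>A x \<le> b\<close> is given by its data \<open>p\<close>, \<open>A\<close>, \<open>b\<close>, \<open>c\<close>, with
  \<open>m = dim_row A\<close> constraints and \<open>n = dim_col A\<close> variables.  Indices start at 0, so the integer
  variables are those with index in \<open>{..<p}\<close>.
\<close>

text \<open>\<open>\<sigma>\<close> is a constraint permutation corresponding to the variable permutation \<open>\<pi>\<close>.\<close>

definition formulation_symmetry_via ::
    "nat \<Rightarrow> real mat \<Rightarrow> real vec \<Rightarrow> real vec \<Rightarrow> (nat \<Rightarrow> nat) \<Rightarrow> (nat \<Rightarrow> nat) \<Rightarrow> bool" where
  "formulation_symmetry_via p A b c \<pi> \<sigma> \<longleftrightarrow>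
     \<pi> permutes {..<dim_col A} \<and>
     \<sigma> permutes {..<dim_row A} \<and>
     \<pi> ` {..<p} = {..<p} \<and>
     (\<forall>j<dim_col A. c $ (\<pi> j) = c $ j) \<and>
     (\<forall>i<dim_row A. b $ (\<sigma> i) = b $ i) \<and>
     (\<forall>i<dim_row A. \<forall>j<dim_col A. A $$ (\<sigma> i, \<pi> j) = A $$ (i, j))"

definition formulation_symmetry ::
    "nat \<Rightarrow> real mat \<Rightarrow> real vec \<Rightarrow> real vec \<Rightarrow> (nat \<Rightarrow> nat) \<Rightarrow> bool" where
  "formulation_symmetry p A b c \<pi> \<longleftrightarrow> (\<exists>\<sigma>. formulation_symmetry_via p A b c \<pi> \<sigma>)"

definition binary_mats :: "nat \<Rightarrow> real mat set" where
  "binary_mats k = {M \<in> carrier_mat k k. \<forall>i<k. \<forall>j<k. M $$ (i, j) \<in> {0, 1}}"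

definition perm_mat :: "nat \<Rightarrow> (nat \<Rightarrow> nat) \<Rightarrow> real mat" where
  "perm_mat k \<tau> = mat k k (\<lambda>(i, i'). if \<tau> i = i' then 1 else 0)"

definition formulation_symmetry_mat ::
    "nat \<Rightarrow> real mat \<Rightarrow> real vec \<Rightarrow> real vec \<Rightarrow> real mat \<Rightarrow> bool" where
  "formulation_symmetry_mat p A b c P \<longleftrightarrow>
     (\<exists>\<pi>. formulation_symmetry p A b c \<pi> \<and> P = perm_mat (dim_col A) \<pi>)"

definition formulation_symmetry_mat_via ::
    "nat \<Rightarrow> real mat \<Rightarrow> real vec \<Rightarrow> real vec \<Rightarrow> real mat \<Rightarrow> real mat \<Rightarrow> bool" where
  "formulation_symmetry_mat_via p A b c P S \<longleftrightarrow>
     (\<exists>\<pi> \<sigma>. formulation_symmetry_via p A b c \<pi> \<sigma> \<and>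
            P = perm_mat (dim_col A) \<pi> \<and> S = perm_mat (dim_row A) \<sigma>)"

definition reasonable_var :: "nat \<Rightarrow> real vec \<Rightarrow> nat \<Rightarrow> nat set" where
  "reasonable_var p c j = {j' \<in> {..<dim_vec c}. (j < p \<longleftrightarrow> j' < p) \<and> c $ j = c $ j'}"

definition reasonable_con :: "real vec \<Rightarrow> nat \<Rightarrow> nat set" where
  "reasonable_con b i = {i' \<in> {..<dim_vec b}. b $ i = b $ i'}"

definition H_B :: "nat \<Rightarrow> real mat \<Rightarrow> real" where
  "H_B k M = (\<Sum>i<k. ((\<Sum>i'<k. M $$ (i, i')) - 1)\<^sup>2) + (\<Sum>i'<k. ((\<Sum>i<k. M $$ (i, i')) - 1)\<^sup>2)"

definition H_var :: "nat \<Rightarrow> real vec \<Rightarrow> real mat \<Rightarrow> real" where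
  "H_var p c P =
     (\<Sum>(j, j') \<in> {(j, j') \<in> {..<dim_vec c} \<times> {..<dim_vec c}. j' \<notin> reasonable_var p c j}.
        (P $$ (j, j'))\<^sup>2)"

definition H_con :: "real vec \<Rightarrow> real mat \<Rightarrow> real" where
  "H_con b S =
     (\<Sum>(i, i') \<in> {(i, i') \<in> {..<dim_vec b} \<times> {..<dim_vec b}. i' \<notin> reasonable_con b i}.
        (S $$ (i, i'))\<^sup>2)"

definition H_A :: "real mat \<Rightarrow> real mat \<Rightarrow> real mat \<Rightarrow> real" where
  "H_A A P S =
     (\<Sum>(i, j, i', j') \<in> {(i, j, i', j') \<in>
          {..<dim_row A} \<times> {..<dim_col A} \<times> {..<dim_row A} \<times> {..<dim_col A}.
          A $$ (i, j) \<noteq> A $$ (i', j')}.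
        S $$ (i, i') * P $$ (j, j'))"

definition H_Full ::
    "nat \<Rightarrow> real mat \<Rightarrow> real vec \<Rightarrow> real vec \<Rightarrow> real mat \<Rightarrow> real mat \<Rightarrow> real" where
  "H_Full p A b c P S =
     H_B (dim_col A) P + H_B (dim_row A) S + H_var p c P + H_con b S + H_A A P S"

end

theory Submission
  imports Defs
begin

text \<open>
  All five terms of the objective are nonnegative on binary matrices, so it vanishes iff each of them
  does.  The \<open>H_B\<close> terms force both matrices to be permutation matrices, and for permutation matrices
  the other three terms vanish exactly when the conditions on \<open>p\<close> and \<open>c\<close>, on \<open>b\<close>, and on \<open>A\<close> in the
  definition of a formulation symmetry hold.
\<close>

text \<open>A sum of 0/1 values counts the indices with value 1, and cardinality one means a unique
  such index.\<close>

lemma binary_sum_eq_1_iff: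
  fixes f :: "'a \<Rightarrow> real"
  assumes "finite I" and "\<And>i. i \<in> I \<Longrightarrow> f i \<in> {0, 1}"
  shows "sum f I = 1 \<longleftrightarrow> (\<exists>!i. i \<in> I \<and> f i = 1)"
proof -
  have "sum f I = (\<Sum>i\<in>I. if f i = 1 then 1 else 0)"
    using assms(2) by (intro sum.cong) auto
  also have "\<dots> = real (card {i \<in> I. f i = 1})"
    using assms(1) by (simp add: sum.If_cases Int_def)
  finally have "sum f I = 1 \<longleftrightarrow> (\<exists>i. {i \<in> I. f i = 1} = {i})"
    by (simp add: card_1_singleton_iff)
  also have "\<dots> \<longleftrightarrow> (\<exists>!i. i \<in> I \<and> f i = 1)"
    unfolding Ex1_def by (rule arg_cong[where f = Ex]) auto
  finally show ?thesis .
qed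

lemma perm_mat_index:
  "i < k \<Longrightarrow> j < k \<Longrightarrow> perm_mat k \<tau> $$ (i, j) = (if \<tau> i = j then 1 else 0)"
  by (simp add: perm_mat_def)

lemma perm_mat_in_binary_mats: "perm_mat k \<tau> \<in> binary_mats k"
  by (auto simp: binary_mats_def perm_mat_def)

lemma permutes_lessThan_iff:
  assumes "\<tau> permutes {..<k::nat}"
  shows "\<tau> i < k \<longleftrightarrow> i < k"
  using permutes_in_image[OF assms, of i] by simp

lemma H_B_nonneg: "0 \<le> H_B k M"
  by (simp add: H_B_def sum_nonneg)

text \<open>A sum of squares vanishes only termwise, so every row sum and column sum must be 1; for
  0/1 entries this is a uniqueness statement.\<close>

lemma H_B_eq_0_iff_unique:
  assumes "M \<in> binary_mats k"
  shows "H_B k M = 0 \<longleftrightarrow>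
    (\<forall>i<k. \<exists>!j. j < k \<and> M $$ (i, j) = 1) \<and> (\<forall>j<k. \<exists>!i. i < k \<and> M $$ (i, j) = 1)"
proof -
  have "H_B k M = 0 \<longleftrightarrow> (\<forall>i<k. (\<Sum>j<k. M $$ (i, j)) = 1) \<and> (\<forall>j<k. (\<Sum>i<k. M $$ (i, j)) = 1)"
    unfolding H_B_def
    by (subst add_nonneg_eq_0_iff) (auto simp: sum_nonneg sum_nonneg_eq_0_iff)
  moreover have "(\<Sum>j<k. M $$ (i, j)) = 1 \<longleftrightarrow> (\<exists>!j. j < k \<and> M $$ (i, j) = 1)" if "i < k" for i
    using assms that by (subst binary_sum_eq_1_iff) (auto simp: binary_mats_def)
  moreover have "(\<Sum>i<k. M $$ (i, j)) = 1 \<longleftrightarrow> (\<exists>!i. i < k \<and> M $$ (i, j) = 1)" if "j < k" for j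
    using assms that by (subst binary_sum_eq_1_iff) (auto simp: binary_mats_def)
  ultimately show ?thesis
    by simp
qed

lemma H_B_perm_mat:
  assumes "\<tau> permutes {..<k}"
  shows "H_B k (perm_mat k \<tau>) = 0"
proof -
  have "\<exists>!j. j < k \<and> perm_mat k \<tau> $$ (i, j) = 1" if "i < k" for i
    using that by (intro ex1I[of _ "\<tau> i"])
      (auto simp: perm_mat_index permutes_lessThan_iff[OF assms] split: if_splits)
  moreover have "\<exists>!i. i < k \<and> perm_mat k \<tau> $$ (i, j) = 1" if "j < k" for j
  proof -
    \<comment> \<open>The 1 in column \<open>j\<close> sits in the row that \<open>\<tau>\<close>
      sends to \<open>j\<close>; this row is in range because the inverse also permutes
      \<open>{..<k}\<close>.\<close>
    have "inv_into UNIV \<tau> j < k"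
      using that permutes_lessThan_iff[OF permutes_inv[OF assms]] by simp
    then show ?thesis
      using that by (intro ex1I[of _ "inv_into UNIV \<tau> j"])
        (auto simp: perm_mat_index permutes_inverses[OF assms] split: if_splits)
  qed
  ultimately show ?thesis
    by (simp add: H_B_eq_0_iff_unique[OF perm_mat_in_binary_mats])
qed

text \<open>Uniqueness in rows yields a function, uniqueness in columns makes it injective, and
  finiteness makes it surjective.\<close>

lemma H_B_eq_0_imp_perm_mat:
  assumes M: "M \<in> binary_mats k" and "H_B k M = 0"
  obtains \<tau> where "\<tau> permutes {..<k}" and "M = perm_mat k \<tau>"
proof -
  have row: "\<exists>!j. j < k \<and> M $$ (i, j) = 1" if "i < k" for i
    using assms that by (simp add: H_B_eq_0_iff_unique)
  have col: "\<exists>!i. i < k \<and> M $$ (i, j) = 1" if "j < k" for j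
    using assms that by (simp add: H_B_eq_0_iff_unique)
  \<comment> \<open>The default value \<open>i\<close> outside the range is what
    \<open>permutes\<close> demands.\<close>
  define \<tau> where "\<tau> i = (if i < k then THE j. j < k \<and> M $$ (i, j) = 1 else i)" for i
  have \<tau>: "\<tau> i < k" "M $$ (i, \<tau> i) = 1" if "i < k" for i
    using theI'[OF row[OF that]] that by (simp_all add: \<tau>_def)
  \<comment> \<open>Two rows with the same image would put two 1s into one column.\<close>
  have "inj_on \<tau> {..<k}"
    using \<tau> col by (intro inj_onI) (metis lessThan_iff)
  then have "\<tau> ` {..<k} = {..<k}"
    using \<tau> by (intro endo_inj_surj) auto
  with \<open>inj_on \<tau> {..<k}\<close> have "\<tau> permutes {..<k}"
    by (intro bij_imp_permutes) (auto simp: bij_betw_def \<tau>_def)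
  moreover have "M $$ (i, j) = perm_mat k \<tau> $$ (i, j)" if "i < k" "j < k" for i j
  proof (cases "\<tau> i = j")
    case True
    with \<tau> that show ?thesis by (auto simp: perm_mat_index)
  next
    case False
    then have "M $$ (i, j) \<noteq> 1" using row \<tau> that by blast
    moreover have "M $$ (i, j) \<in> {0, 1}" using M that by (simp add: binary_mats_def)
    ultimately show ?thesis using False that by (simp add: perm_mat_index)
  qed
  then have "M = perm_mat k \<tau>"
    using M by (intro eq_matI) (auto simp: binary_mats_def perm_mat_def)
  ultimately show thesis ..
qed

lemma H_var_nonneg: "0 \<le> H_var p c P"
  by (auto simp: H_var_def intro!: sum_nonneg)

lemma H_con_nonneg: "0 \<le> H_con b S"
  by (auto simp: H_con_def intro!: sum_nonneg)

text \<open>The summands are products rather than squares, so their sign depends on the entries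
  being binary.\<close>

lemma H_A_nonneg:
  assumes "P \<in> binary_mats (dim_col A)" and "S \<in> binary_mats (dim_row A)"
  shows "0 \<le> H_A A P S"
proof -
  have "0 \<le> P $$ (j, j')" if "j < dim_col A" "j' < dim_col A" for j j'
    using assms(1) that by (fastforce simp: binary_mats_def)
  moreover have "0 \<le> S $$ (i, i')" if "i < dim_row A" "i' < dim_row A" for i i'
    using assms(2) that by (fastforce simp: binary_mats_def)
  ultimately show ?thesis
    by (auto simp: H_A_def intro!: sum_nonneg)
qed

lemma H_Full_eq_0_iff:
  assumes "P \<in> binary_mats (dim_col A)" and "S \<in> binary_mats (dim_row A)"
  shows "H_Full p A b c P S = 0 \<longleftrightarrow>
    H_B (dim_col A) P = 0 \<and> H_B (dim_row A) S = 0 \<and>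
    H_var p c P = 0 \<and> H_con b S = 0 \<and> H_A A P S = 0"
  using H_B_nonneg[of "dim_col A" P] H_B_nonneg[of "dim_row A" S]
    H_var_nonneg[of p c P] H_con_nonneg[of b S] H_A_nonneg[OF assms]
  by (auto simp: H_Full_def)

text \<open>The only entry 1 in row \<open>j\<close> is at column \<open>\<pi> j\<close>, so the
  penalty vanishes exactly when no \<open>j\<close> leaves its reasonable set.\<close>

lemma H_var_perm_mat_eq_0_iff:
  assumes "\<pi> permutes {..<dim_vec c}"
  shows "H_var p c (perm_mat (dim_vec c) \<pi>) = 0 \<longleftrightarrow>
    (\<forall>j<dim_vec c. (\<pi> j < p \<longleftrightarrow> j < p) \<and> c $ \<pi> j = c $ j)"
proof -
  let ?D = "{(j, j') \<in> {..<dim_vec c} \<times> {..<dim_vec c}. j' \<notin> reasonable_var p c j}"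
  have reasonable: "\<pi> j \<in> reasonable_var p c j \<longleftrightarrow> (\<pi> j < p \<longleftrightarrow> j < p) \<and> c $ \<pi> j = c $ j"
    if "j < dim_vec c" for j
    using that by (auto simp: reasonable_var_def permutes_lessThan_iff[OF assms])
  have "finite ?D"
    by (rule finite_subset[of _ "{..<dim_vec c} \<times> {..<dim_vec c}"]) auto
  then have "H_var p c (perm_mat (dim_vec c) \<pi>) = 0 \<longleftrightarrow>
      (\<forall>(j, j') \<in> ?D. perm_mat (dim_vec c) \<pi> $$ (j, j') = 0)"
    unfolding H_var_def by (subst sum_nonneg_eq_0_iff) auto
  also have "\<dots> \<longleftrightarrow> (\<forall>j<dim_vec c. \<pi> j \<in> reasonable_var p c j)"
    by (auto simp: perm_mat_index permutes_lessThan_iff[OF assms])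
  finally show ?thesis
    using reasonable by simp
qed

lemma H_con_perm_mat_eq_0_iff:
  assumes "\<sigma> permutes {..<dim_vec b}"
  shows "H_con b (perm_mat (dim_vec b) \<sigma>) = 0 \<longleftrightarrow> (\<forall>i<dim_vec b. b $ \<sigma> i = b $ i)"
proof -
  let ?D = "{(i, i') \<in> {..<dim_vec b} \<times> {..<dim_vec b}. i' \<notin> reasonable_con b i}"
  have reasonable: "\<sigma> i \<in> reasonable_con b i \<longleftrightarrow> b $ \<sigma> i = b $ i" if "i < dim_vec b" for i
    using that by (auto simp: reasonable_con_def permutes_lessThan_iff[OF assms])
  have "finite ?D"
    by (rule finite_subset[of _ "{..<dim_vec b} \<times> {..<dim_vec b}"]) auto
  then have "H_con b (perm_mat (dim_vec b) \<sigma>) = 0 \<longleftrightarrow>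
      (\<forall>(i, i') \<in> ?D. perm_mat (dim_vec b) \<sigma> $$ (i, i') = 0)"
    unfolding H_con_def by (subst sum_nonneg_eq_0_iff) auto
  also have "\<dots> \<longleftrightarrow> (\<forall>i<dim_vec b. \<sigma> i \<in> reasonable_con b i)"
    by (auto simp: perm_mat_index permutes_lessThan_iff[OF assms])
  finally show ?thesis
    using reasonable by simp
qed

text \<open>A product of entries is nonzero only for \<open>i' = \<sigma> i\<close> and
  \<open>j' = \<pi> j\<close>, so the nonzero summands correspond to the violations of
  invariance.\<close>

lemma H_A_perm_mat_eq_0_iff:
  assumes "\<pi> permutes {..<dim_col A}" and "\<sigma> permutes {..<dim_row A}"
  shows "H_A A (perm_mat (dim_col A) \<pi>) (perm_mat (dim_row A) \<sigma>) = 0 \<longleftrightarrow>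
    (\<forall>i<dim_row A. \<forall>j<dim_col A. A $$ (\<sigma> i, \<pi> j) = A $$ (i, j))"
proof -
  let ?P = "perm_mat (dim_col A) \<pi>" and ?S = "perm_mat (dim_row A) \<sigma>"
  let ?I = "{..<dim_row A} \<times> {..<dim_col A} \<times> {..<dim_row A} \<times> {..<dim_col A}"
  let ?D = "{(i, j, i', j') \<in> ?I. A $$ (i, j) \<noteq> A $$ (i', j')}"
  have "finite ?D"
    by (rule finite_subset[of _ ?I]) auto
  then have "H_A A ?P ?S = 0 \<longleftrightarrow> (\<forall>(i, j, i', j') \<in> ?D. ?S $$ (i, i') * ?P $$ (j, j') = 0)"
    unfolding H_A_def by (subst sum_nonneg_eq_0_iff) (auto simp: perm_mat_index)
  also have "\<dots> \<longleftrightarrow> (\<forall>i<dim_row A. \<forall>j<dim_col A. A $$ (\<sigma> i, \<pi> j) = A $$ (i, j))"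
    (is "?vanish \<longleftrightarrow> ?invariant")
  proof
    assume ?vanish
    show ?invariant
    proof (intro allI impI, rule ccontr)
      fix i j
      assume "i < dim_row A" "j < dim_col A" "A $$ (\<sigma> i, \<pi> j) \<noteq> A $$ (i, j)"
      \<comment> \<open>The violation at \<open>(i, j)\<close> gives a summand in which both factors
        are 1.\<close>
      then have "(i, j, \<sigma> i, \<pi> j) \<in> ?D"
        using assms by (simp add: permutes_lessThan_iff)
      with \<open>?vanish\<close> have "?S $$ (i, \<sigma> i) * ?P $$ (j, \<pi> j) = 0"
        by fast
      with \<open>i < dim_row A\<close> \<open>j < dim_col A\<close> assms show False
        by (simp add: perm_mat_index permutes_lessThan_iff)
    qed
  next
    assume ?invariant
    then show ?vanish
      by (auto simp: perm_mat_index split: if_splits)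
  qed
  finally show ?thesis .
qed

text \<open>This translates between the setwise condition in \<open>formulation_symmetry_via\<close>
  and the pointwise one coming from \<open>reasonable_var\<close>. Forwards, injectivity turns
  membership in the image into membership of the argument. Backwards, an injective self-map of the
  finite set \<open>{..<p}\<close> is onto; \<open>p \<le> n\<close> puts all of its elements in the
  range of the pointwise condition.\<close>

lemma permutes_image_lessThan_iff:
  fixes p n :: nat
  assumes "\<pi> permutes {..<n}" and "p \<le> n"
  shows "\<pi> ` {..<p} = {..<p} \<longleftrightarrow> (\<forall>j<n. \<pi> j < p \<longleftrightarrow> j < p)"
proof
  assume "\<pi> ` {..<p} = {..<p}"
  then show "\<forall>j<n. \<pi> j < p \<longleftrightarrow> j < p"
    using inj_image_mem_iff[OF permutes_inj[OF assms(1)], of _ "{..<p}"] by simp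
next
  assume "\<forall>j<n. \<pi> j < p \<longleftrightarrow> j < p"
  with assms(2) show "\<pi> ` {..<p} = {..<p}"
    by (intro endo_inj_surj) (auto intro: inj_on_subset[OF permutes_inj[OF assms(1)]])
qed

text \<open>Both halves of the final theorem are read off from this equivalence. It keeps
  \<open>\<sigma>\<close> explicit so that the matrix witness for the second half is at
  hand.\<close>

lemma H_Full_perm_mat_eq_0_iff:
  assumes "A \<in> carrier_mat m n" and "b \<in> carrier_vec m" and "c \<in> carrier_vec n" and "p \<le> n"
    and \<pi>: "\<pi> permutes {..<n}" and \<sigma>: "\<sigma> permutes {..<m}"
  shows "H_Full p A b c (perm_mat n \<pi>) (perm_mat m \<sigma>) = 0 \<longleftrightarrow>
    formulation_symmetry_via p A b c \<pi> \<sigma>"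
proof -
  have dims: "dim_row A = m" "dim_col A = n" "dim_vec b = m" "dim_vec c = n"
    using assms by auto
  show ?thesis
    using \<pi> \<sigma> H_Full_eq_0_iff[of "perm_mat n \<pi>" A "perm_mat m \<sigma>" p b c]
      H_var_perm_mat_eq_0_iff[of \<pi> c p] H_con_perm_mat_eq_0_iff[of \<sigma> b]
      H_A_perm_mat_eq_0_iff[of \<pi> A \<sigma>]
    by (auto simp: formulation_symmetry_via_def dims perm_mat_in_binary_mats H_B_perm_mat
        permutes_image_lessThan_iff[OF \<pi> \<open>p \<le> n\<close>])
qed

theorem proposition1:
  fixes m n p :: nat and A :: "real mat" and b c :: "real vec"
  assumes "A \<in> carrier_mat m n" and "b \<in> carrier_vec m" and "c \<in> carrier_vec n" and "p \<le> n"
  shows "(\<forall>P \<in> binary_mats n. \<forall>S \<in> binary_mats m.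
            H_Full p A b c P S = 0 \<longrightarrow> formulation_symmetry_mat p A b c P)
       \<and> (\<forall>P \<in> binary_mats n. formulation_symmetry_mat p A b c P \<longrightarrow>
            (\<exists>S \<in> binary_mats m.
               formulation_symmetry_mat_via p A b c P S \<and> H_Full p A b c P S = 0))"
proof (intro conjI ballI impI)
  have dims: "dim_row A = m" "dim_col A = n"
    using assms by auto
  note zero_iff = H_Full_perm_mat_eq_0_iff[OF assms]
  {
    fix P S
    assume PS: "P \<in> binary_mats n" "S \<in> binary_mats m" and zero: "H_Full p A b c P S = 0"
    then have "H_B n P = 0" "H_B m S = 0"
      using H_Full_eq_0_iff[of P A S] by (simp_all add: dims)
    with PS obtain \<pi> \<sigma> where "\<pi> permutes {..<n}" "P = perm_mat n \<pi>"
        "\<sigma> permutes {..<m}" "S = perm_mat m \<sigma>"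
      by (metis H_B_eq_0_imp_perm_mat)
    \<comment> \<open>The \<open>\<sigma>\<close> read off from \<open>S\<close> is the
      corresponding constraint permutation.\<close>
    with zero zero_iff show "formulation_symmetry_mat p A b c P"
      by (auto simp: formulation_symmetry_mat_def formulation_symmetry_def dims)
  next
    fix P
    assume "formulation_symmetry_mat p A b c P"
    then obtain \<pi> \<sigma> where via: "formulation_symmetry_via p A b c \<pi> \<sigma>" and P: "P = perm_mat n \<pi>"
      by (auto simp: formulation_symmetry_mat_def formulation_symmetry_def dims)
    \<comment> \<open>The witness for \<open>S\<close> is the matrix of a constraint permutation
      corresponding to \<open>\<pi>\<close>.\<close>
    then have "H_Full p A b c P (perm_mat m \<sigma>) = 0"
      using zero_iff[of \<pi> \<sigma>] by (simp add: formulation_symmetry_via_def dims)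
    moreover have "formulation_symmetry_mat_via p A b c P (perm_mat m \<sigma>)"
      using via P by (auto simp: formulation_symmetry_mat_via_def dims)
    ultimately show "\<exists>S \<in> binary_mats m.
        formulation_symmetry_mat_via p A b c P S \<and> H_Full p A b c P S = 0"
      using perm_mat_in_binary_mats by blast
  }
qed

end
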